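(* (1) For every positive integer $n$, the topological group $M_n(\mathbb{C})$ of complex $n \times n$ matrices under addition admits a continuous inverse ambiguous function, one example being $A \mapsto iA$. (2) For every positive integer $n$, the topological group $M_n(\mathbb{R})$ of real $n \times n$ matrices under addition admits a continuous inverse ambiguous function if and only if $n$ is even.
   Context: For a group $G$, a function $f : G \to G$ is called inverse ambiguous if it is bijective and its inverse function satisfies $f^{-1}(x) = (f(x))^{-1}$ for all $x \in G$, where the right-hand side is the group inverse of $f(x)$. Equivalently, $f(f(x)) = x^{-1}$ for all $x \in G$; for an additive matrix group this reads $f(f(A)) = -A$ for all $A$. The function $f$ is not required to be linear. The matrix groups carry their usual Euclidean topology. *)

theory Defs
  imports "HOL-Analysis.Analysis"
begin

text \<open>
  Groups are rendered by the type class \<^class>\<open>group_add\<close>, so the group inverse of \<open>f x\<close> is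
  \<open>- f x\<close>. No linearity or additivity of \<open>f\<close> is required.
\<close>

definition inverse_ambiguous :: "('a::group_add \<Rightarrow> 'a) \<Rightarrow> bool" where
  "inverse_ambiguous f \<longleftrightarrow> bij f \<and> (\<forall>x. inv f x = - f x)"

end

theory Submission
  imports Defs "HOL-Homology.Brouwer_Degree"
begin

text \<open>
  The condition on \<open>f\<close> says \<open>f (f x) = - x\<close>, so \<open>f\<close> is odd and vanishes only at \<open>0\<close>. Hence on a
  Euclidean space of dimension \<open>d\<close> a continuous such \<open>f\<close> normalises to a self-map of the sphere
  of dimension \<open>d - 1\<close> whose square is homotopic to the antipodal map. Taking Brouwer degrees, \<open>(-1)\<^sup>d\<close>
  is a perfect square, so \<open>d\<close> is even. Conversely, if \<open>n\<close> is even, the row indices carry a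
  fixed-point-free involution, and swapping the two rows of each pair while negating one of them
  squares to \<open>-1\<close>.
\<close>

text \<open>The equation alone yields bijectivity: negation is injective, so \<open>f\<close> is,
  and oddness of \<open>f\<close> makes \<open>- f x\<close> an explicit preimage of
  \<open>x\<close>.\<close>

lemma inverse_ambiguous_iff: "inverse_ambiguous f \<longleftrightarrow> (\<forall>x. f (f x) = - x)"
proof
  assume "inverse_ambiguous f"
  then have inj: "inj f" and inv: "inv_into UNIV f y = - f y" for y
    unfolding inverse_ambiguous_def by (blast dest: bij_is_inj)+
  show "\<forall>x. f (f x) = - x"
  proof
    fix x
    have "x = - f (f x)"
      using inv_f_f [OF inj, of x] inv [of "f x"] by (rule trans [OF sym])
    then show "f (f x) = - x"
      by (metis minus_minus)
  qed
next
  assume f: "\<forall>x. f (f x) = - x"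
  \<comment> \<open>Both sides are \<open>f (f (f x))\<close>, bracketed in two ways.\<close>
  have "f (- x) = - f x" for x
    by (metis f)
  then have r: "f (- f x) = x" for x
    by (simp add: f)
  have "inj f"
    by (metis f injI minus_minus)
  moreover have "surj f"
    using r by (rule surjI)
  moreover have "inv_into UNIV f x = - f x" for x
    using \<open>inj f\<close> r by (rule inv_f_eq)
  ultimately show "inverse_ambiguous f"
    unfolding inverse_ambiguous_def by (simp add: bij_def)
qed

text \<open>Oddness gives \<open>f 0 = - f 0\<close>, and a real vector space has no 2-torsion. This
  is what later permits dividing \<open>f x\<close> by its norm.\<close>

lemma inverse_ambiguous_eq_0_iff:
  assumes "inverse_ambiguous f"
  shows "f x = 0 \<longleftrightarrow> x = (0 :: 'a :: real_vector)"
proof -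
  have f: "f (f x) = - x" for x
    using assms by (simp add: inverse_ambiguous_iff)
  have "f (- x) = - f x" for x
    by (metis f)
  from this [of 0] have "f 0 = 0"
    by (metis minus_zero scaleR_2 add.right_inverse scale_eq_0_iff zero_neq_numeral)
  then show ?thesis
    by (metis f neg_equal_0_iff_equal)
qed

section \<open>Degree of the antipodal map\<close>

lemma nsphere_eq_top_of_set:
  "nsphere n = top_of_set {x. (\<Sum>i\<le>n. (x i)\<^sup>2) = 1 \<and> (\<forall>i>n. x i = 0)}"
  by (simp add: nsphere euclidean_product_topology)

lemma continuous_map_nsphere_transpose:
  assumes "k \<le> p"
  shows "continuous_map (nsphere p) (nsphere p) (\<lambda>x. x \<circ> Transposition.transpose 0 k)"
proof -
  let ?t = "Transposition.transpose 0 k"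
  have t: "?t permutes {..p}"
    using assms by (intro permutes_swap_id) auto
  have "(\<Sum>i\<le>p. (x (?t i))\<^sup>2) = (\<Sum>i\<le>p. (x i)\<^sup>2)" for x :: "nat \<Rightarrow> real"
    using sum.permute [OF t, of "\<lambda>i. (x i)\<^sup>2"] by (simp add: o_def)
  moreover have "?t i = i" if "i > p" for i
    using assms that by simp
  moreover have "continuous_on A (\<lambda>x :: nat \<Rightarrow> real. x \<circ> ?t)" for A
    by (rule continuous_on_coordinatewise_then_product)
      (auto simp: o_def intro: continuous_on_subset [OF continuous_on_product_coordinates])
  ultimately show ?thesis
    by (auto simp: nsphere_eq_top_of_set)
qed

text \<open>Swapping coordinates 0 and \<open>k\<close> conjugates this reflection to the one in
  coordinate 0, of degree -1. The swap is an involution, so its degree squares to 1 and drops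
  out.\<close>

lemma Brouwer_degree2_coordinate_reflection:
  assumes "k \<le> p"
  shows "Brouwer_degree2 p (\<lambda>x i. if i = k then - x i else x i) = -1"
proof -
  let ?t = "\<lambda>x :: nat \<Rightarrow> real. x \<circ> Transposition.transpose 0 k"
  let ?r = "\<lambda>k (x :: nat \<Rightarrow> real) i. if i = k then - x i else x i"
  note t = continuous_map_nsphere_transpose [OF assms]
  note r = continuous_map_nsphere_reflection [of p 0]
  have "?t \<circ> ?t = id"
    by (auto simp: fun_eq_iff)
  then have tt: "Brouwer_degree2 p ?t * Brouwer_degree2 p ?t = 1"
    using Brouwer_degree2_compose [OF t t] by simp
  have "?r k = ?t \<circ> (?r 0 \<circ> ?t)"
    by (auto simp: fun_eq_iff Transposition.transpose_def)
  then have "Brouwer_degree2 p (?r k) = Brouwer_degree2 p ?t * (Brouwer_degree2 p (?r 0) * Brouwer_degree2 p ?t)"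
    by (simp only: Brouwer_degree2_compose [OF continuous_map_compose [OF t r] t]
        Brouwer_degree2_compose [OF t r])
  then show ?thesis
    using tt by (simp add: Brouwer_degree2_reflection)
qed

text \<open>The map is a composition of \<open>k\<close> coordinate reflections, going from the
  identity at \<open>k = 0\<close> to the antipodal map at \<open>k = Suc p\<close>. Continuity is
  carried through the induction because multiplicativity of the degree requires it.\<close>

lemma Brouwer_degree2_partial_antipodal:
  assumes "k \<le> Suc p"
  shows "continuous_map (nsphere p) (nsphere p) (\<lambda>x i. if i < k then - x i else x i) \<and>
         Brouwer_degree2 p (\<lambda>x i. if i < k then - x i else x i) = (-1) ^ k"
  using assms
proof (induction k)
  case 0
  show ?case
    using Brouwer_degree2_id [of p] continuous_map_id [of "nsphere p"]
    by (simp add: id_def)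
next
  case (Suc k)
  let ?r = "\<lambda>(x :: nat \<Rightarrow> real) i. if i = k then - x i else x i"
  let ?a = "\<lambda>k (x :: nat \<Rightarrow> real) i. if i < k then - x i else x i"
  have eq: "?a (Suc k) = ?r \<circ> ?a k"
    by (auto simp: fun_eq_iff less_Suc_eq)
  have r: "continuous_map (nsphere p) (nsphere p) ?r"
    by (rule continuous_map_nsphere_reflection)
  have a: "continuous_map (nsphere p) (nsphere p) (?a k)" "Brouwer_degree2 p (?a k) = (-1) ^ k"
    using Suc by auto
  have "Brouwer_degree2 p ?r = -1"
    using Suc.prems by (intro Brouwer_degree2_coordinate_reflection) auto
  then have "Brouwer_degree2 p (?r \<circ> ?a k) = (-1) ^ Suc k"
    using a by (simp add: Brouwer_degree2_compose [OF a(1) r])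
  moreover have "continuous_map (nsphere p) (nsphere p) (?r \<circ> ?a k)"
    using a(1) r by (rule continuous_map_compose)
  ultimately show ?case
    unfolding eq by blast
qed

lemma Brouwer_degree2_antipodal: "Brouwer_degree2 p (\<lambda>x i. - x i) = (-1) ^ Suc p"
proof -
  \<comment> \<open>The two maps agree on the sphere, where all coordinates beyond \<open>p\<close>
    vanish.\<close>
  have "Brouwer_degree2 p (\<lambda>x i. - x i) = Brouwer_degree2 p (\<lambda>x i. if i < Suc p then - x i else x i)"
    by (rule Brouwer_degree2_eq) (auto simp: nsphere fun_eq_iff)
  then show ?thesis
    using Brouwer_degree2_partial_antipodal [of "Suc p" p] by simp
qed

section \<open>Parity of the dimension\<close>

lemma inverse_ambiguous_imp_even_dimension:
  fixes f :: "'a :: euclidean_space \<Rightarrow> 'a"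
  assumes cont: "continuous_on UNIV f" and amb: "inverse_ambiguous f"
  shows "even DIM('a)"
proof -
  obtain p where p: "DIM('a) = Suc p"
    using DIM_positive [where 'a = 'a] gr0_implies_Suc by blast
  obtain e :: "nat \<Rightarrow> 'a" where "bij_betw e {0..<DIM('a)} Basis"
    using ex_bij_betw_nat_finite [OF finite_Basis] by blast
  then have e: "bij_betw e {..p} Basis"
    by (simp add: p atLeast0LessThan lessThan_Suc_atMost)
  have inner_e: "e i \<bullet> e j = (if i = j then 1 else 0)" if "i \<le> p" "j \<le> p" for i j
  proof -
    have "e i \<in> Basis" "e j \<in> Basis" "e i = e j \<longleftrightarrow> i = j"
      using that e by (auto simp: bij_betw_def inj_on_def)
    then show ?thesis
      by (simp add: inner_Basis)
  qed
  \<comment> \<open>Coordinates with respect to the basis \<open>e\<close>, padded with zeros,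
    identify the unit sphere of \<open>'a\<close> with \<open>nsphere p\<close>. \<open>proj\<close>
    ignores the coordinates beyond \<open>p\<close>, so it is inverted by \<open>emb\<close> only
    where these vanish, in particular on \<open>S\<close>.\<close>
  define emb :: "'a \<Rightarrow> nat \<Rightarrow> real" where "emb = (\<lambda>x i. if i \<le> p then x \<bullet> e i else 0)"
  define proj :: "(nat \<Rightarrow> real) \<Rightarrow> 'a" where "proj = (\<lambda>y. \<Sum>i\<le>p. y i *\<^sub>R e i)"
  define S where "S = {x. (\<Sum>i\<le>p. (x i)\<^sup>2) = (1::real) \<and> (\<forall>i>p. x i = 0)}"
  have nsphere_S: "nsphere p = top_of_set S"
    by (simp add: S_def nsphere_eq_top_of_set)
  have proj_emb: "proj (emb x) = x" for x
    using sum.reindex_bij_betw [OF e, of "\<lambda>b. (x \<bullet> b) *\<^sub>R b"]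
    by (simp add: proj_def emb_def euclidean_representation)
  have proj_inner: "proj y \<bullet> e i = y i" if "i \<le> p" for y i
    using that by (simp add: proj_def inner_sum_left inner_e if_distrib cong: if_cong)
  have emb_proj: "emb (proj y) = y" if "y \<in> S" for y
    using that by (auto simp: fun_eq_iff emb_def proj_inner S_def)
  have emb_S: "emb x \<in> S \<longleftrightarrow> norm x = 1" for x
  proof -
    have "(\<Sum>i\<le>p. (emb x i)\<^sup>2) = (norm x)\<^sup>2"
      using sum.reindex_bij_betw [OF e, of "\<lambda>b. (x \<bullet> b)\<^sup>2"]
      by (simp add: emb_def power2_norm_eq_inner euclidean_inner [of x x] flip: power2_eq_square)
    then show ?thesis
      by (simp add: S_def emb_def power2_eq_1_iff) (metis norm_ge_zero not_one_le_zero order_trans neg_0_le_iff_le)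
  qed
  have norm_proj: "norm (proj y) = 1" if "y \<in> S" for y
    using that emb_S [of "proj y"] by (simp add: emb_proj)
  have cont_proj: "continuous_on A proj" for A
    unfolding proj_def
    by (intro continuous_intros continuous_on_subset [OF continuous_on_product_coordinates]) auto
  have cont_emb: "continuous_on A emb" for A
  proof (rule continuous_on_coordinatewise_then_product)
    show "continuous_on A (\<lambda>x. emb x i)" for i
      by (cases "i \<le> p") (auto simp: emb_def intro!: continuous_intros)
  qed
  have cf: "continuous_on A (\<lambda>z. f (g z))" if "continuous_on A g" for A and g :: "'b :: topological_space \<Rightarrow> 'a"
    using continuous_on_compose2 [OF cont that] by simp
  have f0: "f x = 0 \<longleftrightarrow> x = 0" for x
    using amb by (rule inverse_ambiguous_eq_0_iff)
  have proj0: "proj y \<noteq> 0" if "y \<in> S" for y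
    using norm_proj [OF that] by auto

  define F where "F = (\<lambda>y. emb (sgn (f (proj y))))"
  have F: "continuous_map (nsphere p) (nsphere p) F"
    unfolding nsphere_S F_def
    by (auto simp: emb_S norm_sgn f0 proj0
             intro!: continuous_on_compose2 [OF cont_emb] continuous_on_sgn cf cont_proj)
  \<comment> \<open>With \<open>x = proj y\<close>, \<open>F \<circ> F\<close> normalises
    \<open>f (f x / norm (f x))\<close>, while \<open>f (f x) = - x\<close>. As \<open>f\<close>
    need not be homogeneous, these are joined by a homotopy: the inner argument slides along the ray
    from \<open>f x / norm (f x)\<close> at \<open>t = 0\<close> to \<open>f x\<close> at
    \<open>t = 1\<close>, never meeting 0.\<close>
  define H where "H = (\<lambda>(t, y). emb (sgn (f (((1 - t) * inverse (norm (f (proj y))) + t) *\<^sub>R f (proj y)))))"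
  have pos: "(1 - t) * inverse (norm (f (proj y))) + t \<noteq> 0" if "t \<in> {0..1}" "y \<in> S" for t y
  proof (cases "t = 0")
    case False
    with that have "(1 - t) * inverse (norm (f (proj y))) + t > 0"
      by (intro add_nonneg_pos) auto
    then show ?thesis
      by simp
  qed (use that f0 proj0 in auto)
  have "homotopic_with (\<lambda>x. True) (nsphere p) (nsphere p) (F \<circ> F) (\<lambda>x i. - x i)"
  proof (subst homotopic_with, simp, intro exI conjI ballI TrueI)
    have "continuous_on ({0..1} \<times> S) (\<lambda>z. proj (snd z))"
      by (intro continuous_on_compose2 [OF cont_proj [of UNIV]] continuous_intros) auto
    then have "continuous_on ({0..1} \<times> S) H"
      unfolding H_def case_prod_unfold
      by (intro continuous_on_compose2 [OF cont_emb [of UNIV]] continuous_on_sgn cf continuous_intros)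
        (auto simp: f0 proj0 pos)
    moreover have "H \<in> ({0..1} \<times> S) \<rightarrow> S"
      by (auto simp: H_def emb_S norm_sgn f0 proj0 pos)
    ultimately show "continuous_map (prod_topology (top_of_set {0..1}) (nsphere p)) (nsphere p) H"
      by (simp add: nsphere_S)
  next
    fix y
    assume "y \<in> topspace (nsphere p)"
    then have y: "y \<in> S"
      by (simp add: nsphere_S)
    show "H (0, y) = (F \<circ> F) y"
      by (simp add: H_def F_def proj_emb sgn_div_norm)
    have "proj (\<lambda>i. - y i) = - proj y" "(\<lambda>i. - y i) \<in> S"
      using y by (auto simp: proj_def sum_negf S_def)
    then have "emb (- proj y) = (\<lambda>i. - y i)"
      using emb_proj [of "\<lambda>i. - y i"] by simp
    then show "H (1, y) = (\<lambda>i. - y i)"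
      using amb norm_proj [OF y] by (simp add: H_def inverse_ambiguous_iff sgn_div_norm)
  qed
  then have "Brouwer_degree2 p (F \<circ> F) = (-1) ^ Suc p"
    by (simp only: Brouwer_degree2_homotopic Brouwer_degree2_antipodal)
  then have "(-1) ^ Suc p = Brouwer_degree2 p F * Brouwer_degree2 p F"
    by (simp only: Brouwer_degree2_compose [OF F F])
  \<comment> \<open>Degrees are integers, so the square is nonnegative, which excludes the value
    -1.\<close>
  then have "(-1) ^ Suc p \<ge> (0::int)"
    by (simp only: zero_le_square)
  then show ?thesis
    unfolding p by (simp only: zero_le_power_eq) simp
qed

text \<open>Number the elements from 0, pair each even number with its successor, and take as sign
  the parity of the number; partners then have opposite signs.\<close>

lemma even_card_obtains_signed_involution:
  assumes "finite A" "even (card A)"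
  obtains \<sigma> :: "'a \<Rightarrow> 'a" and s :: "'a \<Rightarrow> real"
  where "\<And>i. i \<in> A \<Longrightarrow> \<sigma> i \<in> A" "\<And>i. i \<in> A \<Longrightarrow> \<sigma> (\<sigma> i) = i" "\<And>i. i \<in> A \<Longrightarrow> s i * s (\<sigma> i) = -1"
proof -
  obtain h where h: "bij_betw h A {0..<card A}"
    using ex_bij_betw_finite_nat [OF assms(1)] by blast
  define g where "g = inv_into A h"
  define \<tau> :: "nat \<Rightarrow> nat" where "\<tau> = (\<lambda>k. if even k then Suc k else k - 1)"
  \<comment> \<open>Evenness enters here: for odd \<open>card A\<close> the last number would be
    sent to \<open>card A\<close> itself.\<close>
  have \<tau>: "\<tau> k < card A" if "k < card A" for k
    unfolding \<tau>_def using that assms(2) by presburger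
  have \<tau>\<tau>: "\<tau> (\<tau> k) = k" "even (\<tau> k) \<longleftrightarrow> odd k" for k
    by (auto simp: \<tau>_def elim: oddE)
  have hA: "h i < card A" if "i \<in> A" for i
    using h that by (auto simp: bij_betw_def)
  have gh: "g (h i) = i" if "i \<in> A" for i
    using h that by (simp add: g_def bij_betw_inv_into_left)
  have hg: "h (g k) = k" "g k \<in> A" if "k < card A" for k
    using h that bij_betw_inv_into_right [OF h] bij_betw_inv_into [OF h]
    by (auto simp: g_def bij_betw_def)
  show thesis
  proof
    fix i
    assume i: "i \<in> A"
    show "g (\<tau> (h i)) \<in> A"
      using i by (simp add: hA \<tau> hg)
    show "g (\<tau> (h (g (\<tau> (h i))))) = i"
      using i by (simp add: hA \<tau> hg \<tau>\<tau> gh)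
    show "(-1) ^ h i * (-1) ^ h (g (\<tau> (h i))) = (-1 :: real)"
      using i by (simp add: hA \<tau> hg \<tau>\<tau> uminus_power_if)
  qed
qed

theorem corollary4p4:
  shows "((\<exists>f :: complex ^ 'n ^ 'n \<Rightarrow> complex ^ 'n ^ 'n. continuous_on UNIV f \<and> inverse_ambiguous f)
          \<and> continuous_on UNIV (\<lambda>A :: complex ^ 'n ^ 'n. (\<chi> r c. \<i> * A $ r $ c) :: complex ^ 'n ^ 'n)
          \<and> inverse_ambiguous (\<lambda>A :: complex ^ 'n ^ 'n. (\<chi> r c. \<i> * A $ r $ c) :: complex ^ 'n ^ 'n))
       \<and> ((\<exists>f :: real ^ 'n ^ 'n \<Rightarrow> real ^ 'n ^ 'n. continuous_on UNIV f \<and> inverse_ambiguous f)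
          \<longleftrightarrow> even CARD('n))"
proof -
  let ?c = "\<lambda>A :: complex ^ 'n ^ 'n. (\<chi> r c. \<i> * A $ r $ c) :: complex ^ 'n ^ 'n"
  have c: "continuous_on UNIV ?c" "inverse_ambiguous ?c"
    by (auto simp: inverse_ambiguous_iff vec_eq_iff simp flip: mult.assoc intro!: continuous_intros)
  have "even CARD('n)"
    if "continuous_on UNIV f" "inverse_ambiguous f" for f :: "real ^ 'n ^ 'n \<Rightarrow> real ^ 'n ^ 'n"
    \<comment> \<open>The dimension is the square of \<open>CARD('n)\<close>, which has the same
      parity.\<close>
    using inverse_ambiguous_imp_even_dimension [OF that] by simp
  moreover have "\<exists>f :: real ^ 'n ^ 'n \<Rightarrow> real ^ 'n ^ 'n. continuous_on UNIV f \<and> inverse_ambiguous f"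
    if n: "even CARD('n)"
  proof -
    obtain \<sigma> :: "'n \<Rightarrow> 'n" and s :: "'n \<Rightarrow> real"
      where \<sigma>: "\<And>i. \<sigma> (\<sigma> i) = i" and s: "\<And>i. s i * s (\<sigma> i) = -1"
      using even_card_obtains_signed_involution [of "UNIV :: 'n set"] n by auto
    \<comment> \<open>Applied twice, this multiplies row \<open>r\<close> by
      \<open>s r * s (\<sigma> r) = -1\<close> and returns it to its place.\<close>
    let ?f = "\<lambda>A :: real ^ 'n ^ 'n. (\<chi> r c. s r * A $ \<sigma> r $ c) :: real ^ 'n ^ 'n"
    have "continuous_on UNIV ?f" "inverse_ambiguous ?f"
      by (auto simp: inverse_ambiguous_iff vec_eq_iff \<sigma> s simp flip: mult.assoc intro!: continuous_intros)
    then show ?thesis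
      by blast
  qed
  ultimately show ?thesis
    using c by blast
qed

end
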